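(* Let $c,s\ge 1$ be integers and $\mu\in(0,1)$. Let $S=\{(x,y)\mid 0\le x\le c,\ 0\le y\le s\}$ and, for $(x,y)\in S$, let $$\alpha(x,y)=\binom{c}{x}\mu^x(1-\mu)^{c-x}\binom{s}{y}\mu^y(1-\mu)^{s-y}.$$ Let $P$ be the transition probability matrix on $S$ of either the first game or the second game with constrained adversary (both matrices are given in the context), and let $X=\{X_n, n\ge 0\}$ be the homogeneous Markov chain on $S$ with transition probability matrix $P$ and initial distribution $\alpha$. Then, for both games, the stationary distribution $\pi$ of $X$, i.e. the solution of the linear system $\pi=\pi P$, $\sum_{(x,y)\in S}\pi(x,y)=1$, is equal to $\alpha$; i.e. for all $x=0,\ldots,c$ and $y=0,\ldots,s$, $$\lim_{n\to\infty}\mathbb{P}\{X_n=(x,y)\}=\alpha(x,y).$$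
   Context: Setting. A bag contains a potentially infinite number of balls, a proportion $\mu$ of which are red and $1-\mu$ white (so each ball drawn from the bag is red with probability $\mu$, independently of everything else). There are two urns: $\mathcal C$, always containing $c$ balls at the end of a round, and $\mathcal S$, always containing $s$ balls at the end of a round. The state $(x,y)$ means that $\mathcal C$ contains $x$ red balls and $\mathcal S$ contains $y$ red balls; $X_n$ is the state after round $n$. Initially all $c+s$ balls are drawn from the bag, so $X_0$ has distribution $\alpha$. All draws from urns are uniform. "Constrained adversary" means that the rules below are always applied, regardless of the colour of the balls. Round of the first game: draw a ball $b_0$ from $\mathcal C\cup\mathcal S$. If $b_0$ was in $\mathcal S$, throw it into the bag, then draw a ball $b_2$ from the bag and throw it into $\mathcal S$. If $b_0$ was in $\mathcal C$, throw it into the bag, draw a ball $b_1$ from $\mathcal S$ and throw it into $\mathcal C$, then draw a ball $b_2$ from the bag and throw it into $\mathcal S$. Round of the second game: the same, except that if $b_0$ was in $\mathcal C$, it is thrown into the bag, then $c$ balls are drawn without replacement from the remaining $c+s-1$ balls of $\mathcal S\cup\mathcal C$ and become the content of $\mathcal C$ (the other $s-1$ balls being the content of $\mathcal S$), and finally one ball $b_2$ is drawn from the bag and thrown into $\mathcal S$. Transition matrix of the first game. For $(x,y)\in S$: - $p_{(x,y),(x,y)}=\dfrac{xy+(c(s-y)-xs)(1-\mu)}{(c+s)s}+\dfrac{y\mu+(s-y)(1-\mu)}{c+s}$; - $p_{(x,y),(x,y-1)}=\dfrac{(x+s)y}{(c+s)s}(1-\mu)$ for $y\ge1$; - $p_{(x,y),(x,y+1)}=\dfrac{c-x+s}{c+s}\cdot\dfrac{s-y}{s}\,\mu$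 for $y\le s-1$; - $p_{(x,y),(x+1,y-1)}=\dfrac{(c-x)y}{(c+s)s}(1-\mu)$ for $x\le c-1$, $y\ge1$; - $p_{(x,y),(x+1,y)}=\dfrac{(c-x)y}{(c+s)s}\mu$ for $x\le c-1$; - $p_{(x,y),(x-1,y)}=\dfrac{x(s-y)}{(c+s)s}(1-\mu)$ for $x\ge1$; - $p_{(x,y),(x-1,y+1)}=\dfrac{x(s-y)}{(c+s)s}\mu$ for $x\ge1$, $y\le s-1$; - all other transition probabilities are $0$. Transition matrix of the second game. Let $$q(u,v)=\frac{\binom{v}{u}\binom{c+s-1-v}{c-u}}{\binom{c+s-1}{c}},$$ the probability of getting $u$ red balls when drawing $c$ balls without replacement from an urn with $v$ red and $c+s-1-v$ white balls, with $q(u,v)=0$ when $u>v$ (and $\binom{n}{k}=0$ unless $0\le k\le n$). For $(x,y)\in S$: - $p_{(x,y),(x,y)}=\dfrac{x\,q(x,x+y-1)\mu+(c-x)\,q(x,x+y)(1-\mu)}{c+s}+\dfrac{y\mu+(s-y)(1-\mu)}{c+s}$; - $p_{(x,y),(x,y-1)}=\dfrac{x}{c+s}q(x,x+y-1)(1-\mu)+\dfrac{y}{c+s}(1-\mu)$ for $y\ge1$; - $p_{(x,y),(x,y+1)}=\dfrac{c-x}{c+s}q(x,x+y)\mu+\dfrac{s-y}{c+s}\mu$ for $y\le s-1$; - $p_{(x,y),(k,x+y-k-1)}=\dfrac{x}{c+s}q(k,x+y-1)(1-\mu)$ for $\max(0,x+y-1-s)\le k\le\min(c,x+y-1)$, $k\ne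 x$; - $p_{(x,y),(k,x+y-k)}=\dfrac{x}{c+s}q(k,x+y-1)\mu+\dfrac{c-x}{c+s}q(k,x+y)(1-\mu)$ for $\max(0,x+y-s)\le k\le\min(c,x+y)$, $k\ne x$; - $p_{(x,y),(k,x+y-k+1)}=\dfrac{c-x}{c+s}q(k,x+y)\mu$ for $\max(0,x+y+1-s)\le k\le\min(c,x+y)$, $k\ne x$; - all other transition probabilities are $0$. *)

theory Defs
  imports "HOL-Probability.Probability"
begin

definition states :: "nat \<Rightarrow> nat \<Rightarrow> (nat \<times> nat) set" where
  "states c s = {0..c} \<times> {0..s}"

definition binomial_product :: "nat \<Rightarrow> nat \<Rightarrow> real \<Rightarrow> nat \<times> nat \<Rightarrow> real" where
  "binomial_product c s \<mu> = (\<lambda>(x, y).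
     real (c choose x) * \<mu> ^ x * (1 - \<mu>) ^ (c - x) *
     (real (s choose y) * \<mu> ^ y * (1 - \<mu>) ^ (s - y)))"

text \<open>
  In both matrices the first guard makes every entry with an index outside the state space
  vanish. This also accounts for side conditions such as \<open>y \<le> s - 1\<close> or
  \<open>max(0, x + y - s) \<le> k \<le> min(c, x + y)\<close>, which say that the target state lies in the
  state space. Targets such as \<open>(x, y - 1)\<close> are described by equations without subtraction
  to avoid truncation on the natural numbers.
\<close>

definition first_game :: "nat \<Rightarrow> nat \<Rightarrow> real \<Rightarrow> nat \<times> nat \<Rightarrow> nat \<times> nat \<Rightarrow> real" where
  "first_game c s \<mu> = (\<lambda>(x, y) (x', y').
     if (x, y) \<notin> states c s \<or> (x', y') \<notin> states c s then 0
     else if x' = x \<and> y' = y then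
       (real x * real y + (real c * (real s - real y) - real x * real s) * (1 - \<mu>))
         / ((real c + real s) * real s)
       + (real y * \<mu> + (real s - real y) * (1 - \<mu>)) / (real c + real s)
     else if x' = x \<and> y' + 1 = y then
       (real x + real s) * real y / ((real c + real s) * real s) * (1 - \<mu>)
     else if x' = x \<and> y' = y + 1 then
       (real c - real x + real s) / (real c + real s) * ((real s - real y) / real s) * \<mu>
     else if x' = x + 1 \<and> y' + 1 = y then
       (real c - real x) * real y / ((real c + real s) * real s) * (1 - \<mu>)
     else if x' = x + 1 \<and> y' = y then
       (real c - real x) * real y / ((real c + real s) * real s) * \<mu>
     else if x' + 1 = x \<and> y' = y then
       real x * (real s - real y) / ((real c + real s) * real s) * (1 - \<mu>)
     else if x' + 1 = x \<and> y' = y + 1 then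
       real x * (real s - real y) / ((real c + real s) * real s) * \<mu>
     else 0)"

text \<open>
  Integer arguments are needed because \<open>x + y - 1\<close> and \<open>c + s - 1 - v\<close> can be \<open>-1\<close>
  in the second game; the library's \<open>gchoose\<close> is not zero for negative upper argument.
\<close>

definition int_binomial :: "int \<Rightarrow> int \<Rightarrow> real" where
  "int_binomial n k = (if 0 \<le> k \<and> k \<le> n then real (nat n choose nat k) else 0)"

definition hypergeometric :: "nat \<Rightarrow> nat \<Rightarrow> int \<Rightarrow> int \<Rightarrow> real" where
  "hypergeometric c s u v =
     int_binomial v u * int_binomial (int c + int s - 1 - v) (int c - u)
       / int_binomial (int c + int s - 1) (int c)"

definition second_game :: "nat \<Rightarrow> nat \<Rightarrow> real \<Rightarrow> nat \<times> nat \<Rightarrow> nat \<times> nat \<Rightarrow> real" where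
  "second_game c s \<mu> = (\<lambda>(x, y) (x', y').
     let q = (\<lambda>u. hypergeometric c s (int u)); v = int x + int y in
     if (x, y) \<notin> states c s \<or> (x', y') \<notin> states c s then 0
     else if x' = x \<and> y' = y then
       (real x * q x (v - 1) * \<mu> + (real c - real x) * q x v * (1 - \<mu>)) / (real c + real s)
       + (real y * \<mu> + (real s - real y) * (1 - \<mu>)) / (real c + real s)
     else if x' = x \<and> y' + 1 = y then
       real x / (real c + real s) * q x (v - 1) * (1 - \<mu>)
       + real y / (real c + real s) * (1 - \<mu>)
     else if x' = x \<and> y' = y + 1 then
       (real c - real x) / (real c + real s) * q x v * \<mu>
       + (real s - real y) / (real c + real s) * \<mu>
     else if x' \<noteq> x \<and> x' + y' + 1 = x + y then
       real x / (real c + real s) * q x' (v - 1) * (1 - \<mu>)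
     else if x' \<noteq> x \<and> x' + y' = x + y then
       real x / (real c + real s) * q x' (v - 1) * \<mu>
       + (real c - real x) / (real c + real s) * q x' v * (1 - \<mu>)
     else if x' \<noteq> x \<and> x' + y' = x + y + 1 \<and> x' \<le> x + y then
       (real c - real x) / (real c + real s) * q x' v * \<mu>
     else 0)"

definition markov_chain ::
  "'w measure \<Rightarrow> 'a set \<Rightarrow> ('a \<Rightarrow> 'a \<Rightarrow> real) \<Rightarrow> ('a \<Rightarrow> real) \<Rightarrow> (nat \<Rightarrow> 'w \<Rightarrow> 'a) \<Rightarrow> bool" where
  "markov_chain M S P \<alpha> X \<longleftrightarrow>
     prob_space M \<and>
     (\<forall>n. X n \<in> M \<rightarrow>\<^sub>M count_space S) \<and>
     (\<forall>i\<in>S. \<P>(\<omega> in M. X 0 \<omega> = i) = \<alpha> i) \<and>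
     (\<forall>n z. (\<forall>k\<le>Suc n. z k \<in> S) \<longrightarrow> \<P>(\<omega> in M. \<forall>k\<le>n. X k \<omega> = z k) > 0 \<longrightarrow>
        \<P>(\<omega> in M. X (Suc n) \<omega> = z (Suc n) \<bar> \<forall>k\<le>n. X k \<omega> = z k) = P (z n) (z (Suc n)))"

definition stationary_solution ::
  "'a set \<Rightarrow> ('a \<Rightarrow> 'a \<Rightarrow> real) \<Rightarrow> ('a \<Rightarrow> real) \<Rightarrow> bool" where
  "stationary_solution S P \<pi> \<longleftrightarrow>
     (\<forall>j\<in>S. \<pi> j = (\<Sum>i\<in>S. \<pi> i * P i j)) \<and> (\<Sum>i\<in>S. \<pi> i) = 1"

end

theory Submission
  imports Defs
begin

text \<open>
  In both games \<open>\<alpha>\<close> is invariant because each stage of a round turns independent binomial counts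
  into independent binomial counts. Writing \<open>a\<close> and \<open>b\<close> for the binomial weights of the two urns,
  the moves of a single ball reduce to
  \<open>(x + 1) (1 - \<mu>) a(x + 1) = (c - x) \<mu> a(x)\<close> and its analogue for \<open>b\<close>; the reshuffle of the
  second game is Vandermonde's identity together with the fact that a hypergeometric sample
  from binomially coloured balls is again binomial. Since \<open>\<alpha>\<close> is positive and the chain is
  irreducible, the invariant vector of total mass 1 is unique; and as the chain starts in
  \<open>\<alpha>\<close>, the law of \<open>X n\<close> is constantly \<open>\<alpha>\<close>.
\<close>

subsection \<open>Finite Markov chains\<close>

text \<open>The Markov property speaks only of conditional probabilities given a full history, so
  the event is split over all histories up to time \<open>n\<close>, which are then regrouped by
  their last state.\<close>

lemma markov_chain_step:
  assumes mc: "markov_chain M S P \<alpha> X" and fin: "finite S" and j: "j \<in> S"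
  shows "\<P>(\<omega> in M. X (Suc n) \<omega> = j) = (\<Sum>i\<in>S. \<P>(\<omega> in M. X n \<omega> = i) * P i j)"
proof -
  interpret prob_space M using mc by (simp add: markov_chain_def)
  have X [measurable]: "X k \<in> M \<rightarrow>\<^sub>M count_space S" for k
    using mc by (simp add: markov_chain_def)
  have XS: "X k \<omega> \<in> S" if "\<omega> \<in> space M" for k \<omega>
    using measurable_space[OF X that] by simp
  have ev [measurable]: "{\<omega>\<in>space M. X k \<omega> = i} \<in> events" for k i
  proof (cases "i \<in> S")
    case True
    have "X k -` {i} \<inter> space M \<in> events"
      using True by (intro measurable_sets[OF X]) auto
    moreover have "X k -` {i} \<inter> space M = {\<omega>\<in>space M. X k \<omega> = i}" by auto
    ultimately show ?thesis by simp
  next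
    case False
    then have "{\<omega>\<in>space M. X k \<omega> = i} = {}" using XS by auto
    then show ?thesis by simp
  qed
  \<comment> \<open>Extensional functions, so that each outcome follows exactly one element of
    \<open>paths\<close>.\<close>
  define paths where "paths = PiE {..n} (\<lambda>_. S)"
  define pth where "pth z \<omega> \<longleftrightarrow> (\<forall>k\<le>n. X k \<omega> = z k)" for z \<omega>
  have finp: "finite paths" unfolding paths_def using fin by (intro finite_PiE) auto
  have evp: "{\<omega>\<in>space M. pth z \<omega>} \<in> events" for z
    unfolding pth_def by measurable
  have evpj: "{\<omega>\<in>space M. pth z \<omega> \<and> X m \<omega> = i} \<in> events" for z m i
    using sets.Int[OF evp[of z] ev[of m i]] by (simp add: Collect_conj_eq Int_ac)
  have uniq: "\<exists>!z. z \<in> paths \<and> pth z \<omega>" if w: "\<omega> \<in> space M" for \<omega>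
  proof (rule ex1I[of _ "restrict (\<lambda>k. X k \<omega>) {..n}"])
    show "restrict (\<lambda>k. X k \<omega>) {..n} \<in> paths \<and> pth (restrict (\<lambda>k. X k \<omega>) {..n}) \<omega>"
      using XS[OF w] by (auto simp: paths_def pth_def)
  next
    fix z assume "z \<in> paths \<and> pth z \<omega>"
    then show "z = restrict (\<lambda>k. X k \<omega>) {..n}"
      by (auto simp: paths_def pth_def PiE_def extensional_def restrict_def fun_eq_iff)
  qed
  have total: "\<P>(\<omega> in M. X m \<omega> = i) = (\<Sum>z\<in>paths. \<P>(\<omega> in M. pth z \<omega> \<and> X m \<omega> = i))" for m i
    by (rule prob_sum[OF finp evpj ev]) (use uniq in auto)
  have step: "\<P>(\<omega> in M. pth z \<omega> \<and> X (Suc n) \<omega> = j) = \<P>(\<omega> in M. pth z \<omega>) * P (z n) j"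
    if z: "z \<in> paths" for z
  \<comment> \<open>The Markov property says nothing about histories of probability 0, but for these
    both sides are 0.\<close>
  proof (cases "\<P>(\<omega> in M. pth z \<omega>) = 0")
    case True
    have "\<P>(\<omega> in M. pth z \<omega> \<and> X (Suc n) \<omega> = j) \<le> \<P>(\<omega> in M. pth z \<omega>)"
      by (rule finite_measure_mono[OF _ evp]) auto
    then show ?thesis using True measure_nonneg[of M] by (simp add: order_antisym)
  next
    case False
    then have pos: "\<P>(\<omega> in M. pth z \<omega>) > 0" using measure_nonneg[of M] by (simp add: less_le)
    define z' where "z' = z(Suc n := j)"
    have pz: "pth z \<omega> \<longleftrightarrow> (\<forall>k\<le>n. X k \<omega> = z' k)" for \<omega>
      by (auto simp: pth_def z'_def)
    have "\<forall>k\<le>Suc n. z' k \<in> S" using z j by (auto simp: z'_def paths_def PiE_def Pi_def)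
    then have "\<P>(\<omega> in M. X (Suc n) \<omega> = z' (Suc n) \<bar> pth z \<omega>) = P (z' n) (z' (Suc n))"
      using mc pos unfolding markov_chain_def pz by blast
    then show ?thesis using False
      by (simp add: cond_prob_def z'_def field_simps conj_commute)
  qed
  have last: "(\<Sum>z\<in>paths. if z n = i then \<P>(\<omega> in M. pth z \<omega>) else 0) = \<P>(\<omega> in M. X n \<omega> = i)" for i
    unfolding total[of n i]
  proof (intro sum.cong refl)
    fix z
    have "{\<omega>\<in>space M. pth z \<omega> \<and> X n \<omega> = i} = (if z n = i then {\<omega>\<in>space M. pth z \<omega>} else {})"
      by (auto simp: pth_def)
    then show "(if z n = i then \<P>(\<omega> in M. pth z \<omega>) else 0) = \<P>(\<omega> in M. pth z \<omega> \<and> X n \<omega> = i)"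
      by simp
  qed
  have "\<P>(\<omega> in M. X (Suc n) \<omega> = j) = (\<Sum>z\<in>paths. \<P>(\<omega> in M. pth z \<omega>) * P (z n) j)"
    unfolding total[of "Suc n"] by (intro sum.cong refl step)
  also have "\<dots> = (\<Sum>z\<in>paths. \<Sum>i\<in>S. (if z n = i then \<P>(\<omega> in M. pth z \<omega>) else 0) * P i j)"
  proof (intro sum.cong refl)
    fix z assume "z \<in> paths"
    then have "z n \<in> S" by (auto simp: paths_def)
    then show "\<P>(\<omega> in M. pth z \<omega>) * P (z n) j
        = (\<Sum>i\<in>S. (if z n = i then \<P>(\<omega> in M. pth z \<omega>) else 0) * P i j)"
      using fin by (simp add: if_distrib[of "\<lambda>t. t * _"] cong: if_cong)
  qed
  also have "\<dots> = (\<Sum>i\<in>S. \<P>(\<omega> in M. X n \<omega> = i) * P i j)"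
    by (subst sum.swap) (simp flip: sum_distrib_right add: last)
  finally show ?thesis .
qed

text \<open>Invariance carries the initial law from one round to the next; the limit in the theorem
  is thus that of a constant sequence.\<close>

lemma markov_chain_stationary_law:
  assumes mc: "markov_chain M S P \<alpha> X" and "finite S" and st: "stationary_solution S P \<alpha>"
    and "i \<in> S"
  shows "\<P>(\<omega> in M. X n \<omega> = i) = \<alpha> i"
  using \<open>i \<in> S\<close>
proof (induction n arbitrary: i)
  case 0
  then show ?case using mc by (simp add: markov_chain_def)
next
  case (Suc n)
  have "\<P>(\<omega> in M. X (Suc n) \<omega> = i) = (\<Sum>k\<in>S. \<alpha> k * P k i)"
    unfolding markov_chain_step[OF mc \<open>finite S\<close> Suc.prems]
    by (intro sum.cong refl arg_cong2[where f = "(*)"] Suc.IH)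
  also have "\<dots> = \<alpha> i"
    using st Suc.prems unfolding stationary_solution_def by metis
  finally show ?case .
qed

text \<open>A solution is determined on the state space only; this gives the converse direction of
  the equivalence in the theorem.\<close>

lemma stationary_solution_cong:
  assumes "\<And>i. i \<in> S \<Longrightarrow> \<pi> i = \<rho> i"
  shows "stationary_solution S P \<pi> \<longleftrightarrow> stationary_solution S P \<rho>"
  unfolding stationary_solution_def using assms
  by (intro arg_cong2[where f = "(\<and>)"] ball_cong refl arg_cong2[where f = "(=)"] sum.cong) auto

text \<open>
  Subtracting the largest multiple of \<open>\<alpha>\<close> lying below \<open>\<pi>\<close> leaves a nonnegative invariant
  vector with a zero, and the zeros of such a vector are closed under predecessors.
\<close>

lemma stationary_solution_unique:
  fixes P :: "'a \<Rightarrow> 'a \<Rightarrow> real"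
  assumes fin: "finite S"
    and nonneg: "\<And>i j. i \<in> S \<Longrightarrow> j \<in> S \<Longrightarrow> 0 \<le> P i j"
    and irr: "\<And>Z. Z \<subseteq> S \<Longrightarrow> Z \<noteq> {} \<Longrightarrow> (\<And>i j. j \<in> Z \<Longrightarrow> i \<in> S \<Longrightarrow> 0 < P i j \<Longrightarrow> i \<in> Z) \<Longrightarrow> Z = S"
    and pos: "\<And>i. i \<in> S \<Longrightarrow> 0 < \<alpha> i"
    and st\<alpha>: "stationary_solution S P \<alpha>" and st\<pi>: "stationary_solution S P \<pi>"
    and i: "i \<in> S"
  shows "\<pi> i = \<alpha> i"
proof -
  define t where "t = Min ((\<lambda>i. \<pi> i / \<alpha> i) ` S)"
  define \<nu> where "\<nu> i = \<pi> i - t * \<alpha> i" for i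
  have "S \<noteq> {}" using i by auto
  have ge: "\<nu> i \<ge> 0" if "i \<in> S" for i
  proof -
    have "t \<le> \<pi> i / \<alpha> i" unfolding t_def using fin that by (intro Min_le) auto
    then show ?thesis using pos[OF that] by (simp add: \<nu>_def field_simps)
  qed
  have "t \<in> (\<lambda>i. \<pi> i / \<alpha> i) ` S"
    unfolding t_def using fin \<open>S \<noteq> {}\<close> by (intro Min_in) auto
  then obtain m where m: "m \<in> S" "t = \<pi> m / \<alpha> m" by auto
  then have "\<nu> m = 0" using pos[of m] by (simp add: \<nu>_def)
  have inv: "\<nu> j = (\<Sum>i\<in>S. \<nu> i * P i j)" if "j \<in> S" for j
  proof -
    have "\<pi> j = (\<Sum>i\<in>S. \<pi> i * P i j)" "\<alpha> j = (\<Sum>i\<in>S. \<alpha> i * P i j)"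
      using st\<alpha> st\<pi> that by (auto simp: stationary_solution_def)
    then show ?thesis
      by (simp add: \<nu>_def left_diff_distrib sum_subtractf mult.assoc flip: sum_distrib_left)
  qed
  have "{i\<in>S. \<nu> i = 0} = S"
  proof (rule irr)
    show "{i\<in>S. \<nu> i = 0} \<noteq> {}" using m \<open>\<nu> m = 0\<close> by auto
  next
    fix i j assume j: "j \<in> {i\<in>S. \<nu> i = 0}" and "i \<in> S" and p: "0 < P i j"
    then have "(\<Sum>i\<in>S. \<nu> i * P i j) = 0" using inv[of j] by simp
    then have "\<nu> i * P i j = 0"
      using fin \<open>i \<in> S\<close> j ge nonneg by (subst (asm) sum_nonneg_eq_0_iff) auto
    then show "i \<in> {i\<in>S. \<nu> i = 0}" using p \<open>i \<in> S\<close> by simp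
  qed auto
  then have eq: "\<pi> i = t * \<alpha> i" if "i \<in> S" for i using that by (auto simp: \<nu>_def)
  have "(\<Sum>i\<in>S. \<pi> i) = t * (\<Sum>i\<in>S. \<alpha> i)" unfolding sum_distrib_left by (intro sum.cong refl eq)
  moreover have "(\<Sum>i\<in>S. \<pi> i) = 1" "(\<Sum>i\<in>S. \<alpha> i) = 1"
    using st\<alpha> st\<pi> unfolding stationary_solution_def by blast+
  ultimately have "t = 1" by simp
  then show ?thesis using eq[OF i] by simp
qed

text \<open>The four kinds of moves are positive in both games. Closure runs against the arrows:
  \<open>up\<close> leads from a state of \<open>Z\<close> down to the bottom row,
  \<open>right\<close> leads to smaller \<open>x\<close>, \<open>left\<close> to larger
  \<open>x\<close>, and \<open>down\<close> fills the columns.\<close>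

lemma states_irreducible:
  fixes P :: "nat \<times> nat \<Rightarrow> nat \<times> nat \<Rightarrow> real"
  assumes s: "s \<ge> 1"
    and up: "\<And>x y. x \<le> c \<Longrightarrow> y < s \<Longrightarrow> 0 < P (x, y) (x, Suc y)"
    and down: "\<And>x y. x \<le> c \<Longrightarrow> y < s \<Longrightarrow> 0 < P (x, Suc y) (x, y)"
    and left: "\<And>x. x < c \<Longrightarrow> 0 < P (Suc x, 0) (x, 0)"
    and right: "\<And>x. x < c \<Longrightarrow> 0 < P (x, 1) (Suc x, 0)"
    and Z: "Z \<subseteq> states c s" "Z \<noteq> {}"
    and closed: "\<And>i j. j \<in> Z \<Longrightarrow> i \<in> states c s \<Longrightarrow> 0 < P i j \<Longrightarrow> i \<in> Z"
  shows "Z = states c s"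
proof -
  have down0: "(x, 0) \<in> Z" if "(x, y) \<in> Z" for x y
    using that
  proof (induction y)
    case (Suc y)
    then have "x \<le> c" "y < s" using Z(1) by (auto simp: states_def)
    then have "(x, y) \<in> Z" by (intro closed[OF Suc.prems] up) (auto simp: states_def)
    then show ?case by (rule Suc.IH)
  qed
  have col: "(x, y) \<in> Z" if "(x, 0) \<in> Z" "y \<le> s" for x y
    using that(2)
  proof (induction y)
    case (Suc y)
    then have "x \<le> c" "y < s" "(x, y) \<in> Z" using Z(1) that(1) by (auto simp: states_def)
    then show ?case by (intro closed[OF \<open>(x, y) \<in> Z\<close>] down) (auto simp: states_def)
  qed (use that in auto)
  obtain x0 y0 where "(x0, y0) \<in> Z" using Z(2) by auto
  then have x0: "(x0, 0) \<in> Z" "x0 \<le> c" using Z(1) down0 by (auto simp: states_def)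
  \<comment> \<open>Truncated subtraction makes the walk rest at 0, so \<open>d = x0\<close> reaches
    the corner.\<close>
  have lower: "(x0 - d, 0) \<in> Z" for d
  proof (induction d)
    case (Suc d)
    show ?case
    proof (cases "d < x0")
      case True
      then have eq: "x0 - d = Suc (x0 - Suc d)" by simp
      have "(x0 - Suc d, 1) \<in> Z"
        using True x0 s by (intro closed[OF Suc] right[of "x0 - Suc d", folded eq]) (auto simp: states_def)
      then show ?thesis by (rule down0)
    qed (use Suc in simp)
  qed (use x0 in simp)
  have zero: "(0, 0) \<in> Z" using lower[of x0] by simp
  have row: "(x, 0) \<in> Z" if "x \<le> c" for x
    using that
  proof (induction x)
    case (Suc x)
    then have "(x, 0) \<in> Z" by simp
    then show ?case using Suc.prems by (intro closed[OF \<open>(x, 0) \<in> Z\<close>] left) (auto simp: states_def)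
  qed (rule zero)
  show ?thesis using Z(1) row col by (auto simp: states_def)
qed

subsection \<open>Binomial weights\<close>

definition binomial_weight :: "real \<Rightarrow> nat \<Rightarrow> nat \<Rightarrow> real" where
  "binomial_weight \<mu> n x = real (n choose x) * \<mu> ^ x * (1 - \<mu>) ^ (n - x)"

lemma binomial_product_eq:
  "binomial_product c s \<mu> (x, y) = binomial_weight \<mu> c x * binomial_weight \<mu> s y"
  by (simp add: binomial_product_def binomial_weight_def)

lemma binomial_weight_eq_0: "n < x \<Longrightarrow> binomial_weight \<mu> n x = 0"
  by (simp add: binomial_weight_def)

lemma sum_binomial_weight: "(\<Sum>x\<in>{0..n}. binomial_weight \<mu> n x) = 1"
  using binomial_ring[of \<mu> "1 - \<mu>" n] by (simp add: binomial_weight_def atLeast0AtMost)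

text \<open>Absorption: marking a white ball among \<open>Suc n\<close> and removing it leaves
  \<open>n\<close> independent balls. With a real difference both sides vanish for every
  \<open>x > n\<close>.\<close>

lemma binomial_weight_Suc_white:
  "(real (Suc n) - real x) * binomial_weight \<mu> (Suc n) x
     = real (Suc n) * (1 - \<mu>) * binomial_weight \<mu> n x"
proof (cases "x \<le> n")
  case True
  have "(Suc n - x) * (Suc n choose x) = Suc n * (n choose x)"
    using binomial_absorb_comp[of "Suc n" x] by simp
  then have "(real (Suc n) - real x) * real (Suc n choose x) = real (Suc n) * real (n choose x)"
    using True by (metis of_nat_diff of_nat_mult le_SucI)
  then show ?thesis using True
    by (simp add: binomial_weight_def Suc_diff_le)
next
  case False
  then show ?thesis by (cases "x = Suc n") (simp_all add: binomial_weight_eq_0)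
qed

lemma binomial_weight_Suc_red:
  "real (Suc x) * binomial_weight \<mu> (Suc n) (Suc x) = real (Suc n) * \<mu> * binomial_weight \<mu> n x"
proof -
  have "real (Suc x) * real (Suc n choose Suc x) = real (Suc n) * real (n choose x)"
    using Suc_times_binomial_eq[of n x] by (metis mult.commute of_nat_mult)
  then show ?thesis by (simp add: binomial_weight_def)
qed

text \<open>Detailed balance for exchanging one ball with the bag: for \<open>n > 0\<close> both
  sides equal \<open>n * \<mu> * (1 - \<mu>)\<close> times the weight of \<open>x\<close> for one
  ball fewer.\<close>

lemma binomial_weight_Suc_shift:
  "real (Suc x) * (1 - \<mu>) * binomial_weight \<mu> n (Suc x) = (real n - real x) * \<mu> * binomial_weight \<mu> n x"
proof (cases n)
  case (Suc m)
  have "real (Suc x) * binomial_weight \<mu> n (Suc x) * (1 - \<mu>)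
      = (real n - real x) * binomial_weight \<mu> n x * \<mu>"
    unfolding Suc binomial_weight_Suc_red binomial_weight_Suc_white by (simp add: mult_ac)
  then show ?thesis by (simp only: mult_ac)
qed (cases "x = 0"; simp add: binomial_weight_def)

text \<open>Detailed balance turns the inflow into \<open>k\<close> from its upper neighbour into a
  multiple of the weight at \<open>k\<close>.\<close>

lemma sum_weight_red_loss:
  "(\<Sum>x\<in>{0..n}. binomial_weight \<mu> n x * (of_bool (x = Suc k) * real x * (1 - \<mu>)))
     = (real n - real k) * \<mu> * binomial_weight \<mu> n k"
proof -
  have "(\<Sum>x\<in>{0..n}. binomial_weight \<mu> n x * (of_bool (x = Suc k) * real x * (1 - \<mu>)))
      = (\<Sum>x\<in>{0..n}. if x = Suc k then real (Suc k) * (1 - \<mu>) * binomial_weight \<mu> n (Suc k) else 0)"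
    by (intro sum.cong) auto
  also have "\<dots> = real (Suc k) * (1 - \<mu>) * binomial_weight \<mu> n (Suc k)"
    by (auto simp: binomial_weight_eq_0)
  finally show ?thesis by (simp only: binomial_weight_Suc_shift)
qed

lemma sum_weight_red_gain:
  assumes "k \<le> n"
  shows "(\<Sum>x\<in>{0..n}. binomial_weight \<mu> n x * (of_bool (k = Suc x) * (real n - real x) * \<mu>))
     = real k * (1 - \<mu>) * binomial_weight \<mu> n k"
proof (cases k)
  case (Suc m)
  have "(\<Sum>x\<in>{0..n}. binomial_weight \<mu> n x * (of_bool (k = Suc x) * (real n - real x) * \<mu>))
      = (\<Sum>x\<in>{0..n}. if x = m then (real n - real m) * \<mu> * binomial_weight \<mu> n m else 0)"
    using Suc by (intro sum.cong) auto
  also have "\<dots> = (real n - real m) * \<mu> * binomial_weight \<mu> n m"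
    using Suc assms by simp
  finally show ?thesis by (simp only: binomial_weight_Suc_shift Suc)
qed simp

lemma sum_weight_stay:
  assumes "k \<le> n"
  shows "(\<Sum>x\<in>{0..n}. binomial_weight \<mu> n x * (of_bool (x = k) * g x)) = g k * binomial_weight \<mu> n k"
proof -
  have "(\<Sum>x\<in>{0..n}. binomial_weight \<mu> n x * (of_bool (x = k) * g x))
      = (\<Sum>x\<in>{0..n}. if x = k then g k * binomial_weight \<mu> n k else 0)"
    by (intro sum.cong) auto
  then show ?thesis using assms by simp
qed

text \<open>In a convolution of two binomial laws with the same \<mu> the powers depend only on
  \<open>r\<close>, which leaves Vandermonde's identity for the coefficients.\<close>

lemma binomial_weight_vandermonde:
  "(\<Sum>u\<in>{0..m}. \<Sum>y\<in>{0..n}. binomial_weight \<mu> m u * binomial_weight \<mu> n y * of_bool (u + y = r))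
     = binomial_weight \<mu> (m + n) r"
proof -
  have inner: "(\<Sum>y\<in>{0..n}. binomial_weight \<mu> m u * binomial_weight \<mu> n y * of_bool (u + y = r))
      = (if u \<le> r then binomial_weight \<mu> m u * binomial_weight \<mu> n (r - u) else 0)" for u
  proof -
    have "(\<Sum>y\<in>{0..n}. binomial_weight \<mu> m u * binomial_weight \<mu> n y * of_bool (u + y = r))
      = (\<Sum>y\<in>{0..n}. if y = r - u then
          (if u \<le> r then binomial_weight \<mu> m u * binomial_weight \<mu> n (r - u) else 0) else 0)"
      by (intro sum.cong) auto
    then show ?thesis by (auto simp: binomial_weight_eq_0)
  qed
  have "(\<Sum>u\<in>{0..m}. if u \<le> r then binomial_weight \<mu> m u * binomial_weight \<mu> n (r - u) else 0)
      = (\<Sum>u\<in>{0..m} \<inter> {..r}. binomial_weight \<mu> m u * binomial_weight \<mu> n (r - u))"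
    by (auto simp: sum.If_cases intro!: sum.cong)
  \<comment> \<open>The range becomes that of \<open>vandermonde\<close>; the new terms have
    \<open>u > m\<close> and weight 0.\<close>
  also have "\<dots> = (\<Sum>u\<le>r. binomial_weight \<mu> m u * binomial_weight \<mu> n (r - u))"
    by (intro sum.mono_neutral_left) (auto simp: binomial_weight_eq_0)
  also have "\<dots> = (\<Sum>u\<le>r. real ((m choose u) * (n choose (r - u))) * (\<mu> ^ r * (1 - \<mu>) ^ (m + n - r)))"
  proof (intro sum.cong refl)
    fix u assume u: "u \<in> {..r}"
    show "binomial_weight \<mu> m u * binomial_weight \<mu> n (r - u)
        = real ((m choose u) * (n choose (r - u))) * (\<mu> ^ r * (1 - \<mu>) ^ (m + n - r))"
    proof (cases "u \<le> m \<and> r - u \<le> n")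
      case True
      have "\<mu> ^ r = \<mu> ^ u * \<mu> ^ (r - u)" using u by (simp flip: power_add)
      moreover have "m + n - r = (m - u) + (n - (r - u))" using u True by auto
      ultimately show ?thesis by (simp add: binomial_weight_def power_add)
    next
      case False
      then show ?thesis by (auto simp: binomial_weight_eq_0)
    qed
  qed
  also have "\<dots> = binomial_weight \<mu> (m + n) r"
    unfolding sum_distrib_right[symmetric] of_nat_sum[symmetric] vandermonde
    by (simp add: binomial_weight_def)
  finally show ?thesis by (simp add: inner)
qed

lemma sum_states: "(\<Sum>i\<in>states c s. f i) = (\<Sum>x\<in>{0..c}. \<Sum>y\<in>{0..s}. f (x, y))"
  by (simp add: states_def sum.cartesian_product)

text \<open>Independence of the urns. \<open>first_game_eq\<close> brings every summand into this
  shape, \<open>second_game_eq\<close> those for a ball drawn from the second urn.\<close>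

lemma sum_weights_product:
  "(\<Sum>x\<in>{0..c}. \<Sum>y\<in>{0..s}. binomial_weight \<mu> c x * binomial_weight \<mu> s y * (f x * g y))
     = (\<Sum>x\<in>{0..c}. binomial_weight \<mu> c x * f x) * (\<Sum>y\<in>{0..s}. binomial_weight \<mu> s y * g y)"
  by (simp add: sum_product mult_ac)

subsection \<open>The first game\<close>

text \<open>Each summand is a product of a factor in \<open>x\<close> and a factor in
  \<open>y\<close>. The first two, where b_0 comes from the first urn and b_0, b_1, b_2 share a
  colour, spell out the first fraction of the diagonal entry.\<close>

lemma first_game_eq:
  assumes "x \<le> c" "y \<le> s" "k \<le> c" "l \<le> s" "s \<ge> 1"
  shows "first_game c s \<mu> (x, y) (k, l) =
    ((of_bool (x = k) * real x) * (of_bool (y = l) * (real y * \<mu>))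
     + (of_bool (x = k) * (real c - real x)) * (of_bool (y = l) * ((real s - real y) * (1 - \<mu>)))
     + (of_bool (x = k) * real s) * (of_bool (y = l) * (real y * \<mu> + (real s - real y) * (1 - \<mu>)))
     + (of_bool (x = k) * (real x + real s)) * (of_bool (y = Suc l) * real y * (1 - \<mu>))
     + (of_bool (x = k) * (real c - real x + real s)) * (of_bool (l = Suc y) * (real s - real y) * \<mu>)
     + (of_bool (k = Suc x) * (real c - real x)) * (of_bool (y = Suc l) * real y * (1 - \<mu>))
     + (of_bool (k = Suc x) * (real c - real x)) * (of_bool (y = l) * (real y * \<mu>))
     + (of_bool (x = Suc k) * real x) * (of_bool (y = l) * ((real s - real y) * (1 - \<mu>)))
     + (of_bool (x = Suc k) * real x) * (of_bool (l = Suc y) * (real s - real y) * \<mu>))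
    / ((real c + real s) * real s)"
proof -
  obtain D where D: "real c + real s = D" by blast
  then have nz: "D \<noteq> 0" "real s \<noteq> 0" using assms by auto
  have x: "k = x \<or> k = Suc x \<or> x = Suc k \<or> (k \<noteq> x \<and> k \<noteq> Suc x \<and> x \<noteq> Suc k)" by blast
  have y: "l = y \<or> l = Suc y \<or> y = Suc l \<or> (l \<noteq> y \<and> l \<noteq> Suc y \<and> y \<noteq> Suc l)" by blast
  show ?thesis
    using assms x y nz
    unfolding D by (elim disjE; simp add: first_game_def states_def D; simp add: field_simps)
qed

text \<open>The term \<open>- real x * real s\<close> obscures the sign of the diagonal entry; in
  the form of \<open>first_game_eq\<close> all factors are visibly nonnegative.\<close>

lemma first_game_nonneg:
  assumes "i \<in> states c s" "j \<in> states c s" "s \<ge> 1" "0 < \<mu>" "\<mu> < 1"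
  shows "0 \<le> first_game c s \<mu> i j"
proof -
  obtain x y k l where "i = (x, y)" "j = (k, l)" by fastforce
  with assms show ?thesis
    by (auto simp: states_def first_game_eq intro!: divide_nonneg_nonneg add_nonneg_nonneg mult_nonneg_nonneg)
qed

lemma first_game_invariant:
  assumes "k \<le> c" "l \<le> s" "s \<ge> 1"
  shows "(\<Sum>i\<in>states c s. binomial_product c s \<mu> i * first_game c s \<mu> i (k, l))
    = binomial_product c s \<mu> (k, l)"
proof -
  let ?N = "(real c + real s) * real s"
  have nz: "?N \<noteq> 0" using assms by auto
  define a where "a = binomial_weight \<mu> c"
  define b where "b = binomial_weight \<mu> s"
  \<comment> \<open>\<open>G\<close> and \<open>L\<close> are the flows into \<open>x = k\<close>
    from \<open>k - 1\<close> and \<open>k + 1\<close>, still without the colour factor that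
    detailed balance requires.\<close>
  define G where "G = (\<Sum>x\<in>{0..c}. a x * (of_bool (k = Suc x) * (real c - real x)))"
  define L where "L = (\<Sum>x\<in>{0..c}. a x * (of_bool (x = Suc k) * real x))"
  have G: "G * \<mu> = real k * (1 - \<mu>) * a k"
    using sum_weight_red_gain[OF assms(1), of \<mu>] by (simp add: G_def a_def sum_distrib_left mult_ac)
  have L: "L * (1 - \<mu>) = (real c - real k) * \<mu> * a k"
    using sum_weight_red_loss[where n = c and \<mu> = \<mu> and k = k]
    by (simp add: L_def a_def sum_distrib_left mult_ac)
  have "(\<Sum>i\<in>states c s. binomial_product c s \<mu> i * first_game c s \<mu> i (k, l)) * ?N
    = (\<Sum>x\<in>{0..c}. \<Sum>y\<in>{0..s}. binomial_weight \<mu> c x * binomial_weight \<mu> s y *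
       (first_game c s \<mu> (x, y) (k, l) * ?N))"
    by (simp only: sum_states sum_distrib_right binomial_product_eq mult.assoc)
  also have "\<dots> = (\<Sum>x\<in>{0..c}. \<Sum>y\<in>{0..s}. binomial_weight \<mu> c x * binomial_weight \<mu> s y *
   ((of_bool (x = k) * real x) * (of_bool (y = l) * (real y * \<mu>))
   + (of_bool (x = k) * (real c - real x)) * (of_bool (y = l) * ((real s - real y) * (1 - \<mu>)))
   + (of_bool (x = k) * real s) * (of_bool (y = l) * (real y * \<mu> + (real s - real y) * (1 - \<mu>)))
   + (of_bool (x = k) * (real x + real s)) * (of_bool (y = Suc l) * real y * (1 - \<mu>))
   + (of_bool (x = k) * (real c - real x + real s)) * (of_bool (l = Suc y) * (real s - real y) * \<mu>)
   + (of_bool (k = Suc x) * (real c - real x)) * (of_bool (y = Suc l) * real y * (1 - \<mu>))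
   + (of_bool (k = Suc x) * (real c - real x)) * (of_bool (y = l) * (real y * \<mu>))
   + (of_bool (x = Suc k) * real x) * (of_bool (y = l) * ((real s - real y) * (1 - \<mu>)))
   + (of_bool (x = Suc k) * real x) * (of_bool (l = Suc y) * (real s - real y) * \<mu>)))"
    using assms nz
    by (intro sum.cong refl arg_cong2[where f = "(*)"])
      (simp only: first_game_eq atLeastAtMost_iff times_divide_eq_left nonzero_mult_div_cancel_right not_False_eq_True)
  also have "\<dots> = (real k * a k) * (l * \<mu> * b l)
   + ((real c - real k) * a k) * ((real s - real l) * (1 - \<mu>) * b l)
   + (real s * a k) * ((real l * \<mu> + (real s - real l) * (1 - \<mu>)) * b l)
   + ((real k + real s) * a k) * ((real s - real l) * \<mu> * b l)
   + ((real c - real k + real s) * a k) * (real l * (1 - \<mu>) * b l)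
   + G * ((real s - real l) * \<mu> * b l) + G * (real l * \<mu> * b l)
   + L * ((real s - real l) * (1 - \<mu>) * b l) + L * (real l * (1 - \<mu>) * b l)"
    unfolding distrib_left[of "binomial_weight \<mu> c _ * binomial_weight \<mu> s _"] sum.distrib sum_weights_product
    by (simp only: sum_weight_red_loss sum_weight_red_gain[OF assms(2)] sum_weight_stay[OF assms(1)]
        sum_weight_stay[OF assms(2)] G_def L_def a_def b_def)
  also have "\<dots> = a k * b l * ?N"
  proof -
    \<comment> \<open>The other urn supplies the missing factor: two contributions together complete
      \<open>G\<close> to \<open>G * \<mu>\<close> and, below, \<open>L\<close> to
      \<open>L * (1 - \<mu>)\<close>.\<close>
    have G': "G * ((real s - real l) * \<mu> * b l) + G * (real l * \<mu> * b l) = (G * \<mu>) * (real s * b l)"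
      by (simp add: algebra_simps)
    have L': "L * ((real s - real l) * (1 - \<mu>) * b l) + L * (real l * (1 - \<mu>) * b l)
      = (L * (1 - \<mu>)) * (real s * b l)"
      by (simp add: algebra_simps)
    show ?thesis using G' L' unfolding G L by (simp add: algebra_simps)
  qed
  finally have "(\<Sum>i\<in>states c s. binomial_product c s \<mu> i * first_game c s \<mu> i (k, l)) = a k * b l"
    using nz by (metis mult_right_cancel)
  then show ?thesis by (simp add: binomial_product_eq a_def b_def)
qed

subsection \<open>The second game\<close>

lemma hypergeometric_eq_0:
  "v < u \<Longrightarrow> hypergeometric c s u v = 0"
  by (simp add: hypergeometric_def int_binomial_def)

lemma hypergeometric_nonneg: "0 \<le> hypergeometric c s u v"
  by (simp add: hypergeometric_def int_binomial_def)

text \<open>The sample takes all \<open>u\<close> red balls, and \<open>s \<ge> 1\<close> leaves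
  enough white ones to complete it. This makes the moves between columns possible.\<close>

lemma hypergeometric_all_red_pos:
  assumes "u \<le> c" "s \<ge> 1"
  shows "0 < hypergeometric c s (int u) (int u)"
proof -
  have "nat (int c - int u) \<le> nat (int c + int s - 1 - int u)" using assms by simp
  then show ?thesis using assms
    by (simp add: hypergeometric_def int_binomial_def)
qed

text \<open>
  Drawing \<open>c\<close> out of \<open>c + t\<close> balls of independent random colours gives independent
  binomial counts for the drawn and the remaining balls.
\<close>

lemma binomial_weight_hypergeometric:
  assumes "u \<le> c"
  shows "binomial_weight \<mu> (c + t) v * hypergeometric c (Suc t) (int u) (int v)
    = (if u \<le> v then binomial_weight \<mu> c u * binomial_weight \<mu> t (v - u) else 0)"
proof (cases "u \<le> v \<and> v - u \<le> t")
  case True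
  have hyp: "hypergeometric c (Suc t) (int u) (int v)
    = real (v choose u) * real ((c + t - v) choose (c - u)) / real ((c + t) choose c)"
  proof -
    have int_eqs: "int c + int (Suc t) - 1 = int (c + t)" "int (c + t) - int v = int (c + t - v)"
      "int c - int u = int (c - u)"
      using True assms by auto
    have "u \<le> v" "c \<le> c + t" "c - u \<le> c + t - v" using True assms by auto
    then show ?thesis
      by (simp only: hypergeometric_def int_binomial_def int_eqs nat_int of_nat_0_le_iff of_nat_le_iff
          simp_thms if_True)
  qed
  have pow: "\<mu> ^ v = \<mu> ^ u * \<mu> ^ (v - u)"
    "(1 - \<mu>) ^ (c + t - v) = (1 - \<mu>) ^ (c - u) * (1 - \<mu>) ^ (t - (v - u))"
  proof -
    have "v = u + (v - u)" "c + t - v = (c - u) + (t - (v - u))" using True assms by auto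
    then show "\<mu> ^ v = \<mu> ^ u * \<mu> ^ (v - u)"
      "(1 - \<mu>) ^ (c + t - v) = (1 - \<mu>) ^ (c - u) * (1 - \<mu>) ^ (t - (v - u))"
      by (metis power_add)+
  qed
  \<comment> \<open>Both sides count pairs of a set of \<open>v\<close> red balls and a set of
    \<open>c\<close> drawn balls, among \<open>c + t\<close>, with \<open>u\<close> balls in
    common.\<close>
  have "real ((c + t) choose v) * (real (v choose u) * real ((c + t - v) choose (c - u)))
    = real (c choose u) * real (t choose (v - u)) * real ((c + t) choose c)"
  proof -
    have "c + t - v - (c - u) = t - (v - u)" using True assms by auto
    moreover have "v \<le> c + t" "c - u \<le> c + t - v" using True assms by auto
    ultimately show ?thesis using True assms by (simp add: binomial_fact)
  qed
  moreover have "real ((c + t) choose c) \<noteq> 0" by simp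
  ultimately have "real ((c + t) choose v) * hypergeometric c (Suc t) (int u) (int v)
    = real (c choose u) * real (t choose (v - u))"
    unfolding hyp
    by (simp only: times_divide_eq_right nonzero_mult_div_cancel_right not_False_eq_True)
  then show ?thesis using True by (simp add: binomial_weight_def pow)
next
  case False
  show ?thesis
  proof (cases "u \<le> v")
    case True
    then have "int (c + t) - int v < int c - int u" using False by auto
    then have "hypergeometric c (Suc t) (int u) (int v) = 0"
      by (simp add: hypergeometric_def int_binomial_def)
    then show ?thesis using False True by (simp add: binomial_weight_eq_0)
  qed (simp add: hypergeometric_eq_0)
qed

text \<open>The reshuffled balls contain \<open>k + l - 1\<close> or \<open>k + l\<close> red ones
  according as the bag ball is red or white, so the hypergeometric factors depend on the target only
  and come out of the sum over sources.\<close>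

lemma second_game_eq:
  assumes "x \<le> c" "y \<le> s" "k \<le> c" "l \<le> s" "s \<ge> 1"
  shows "second_game c s \<mu> (x, y) (k, l) =
    ((of_bool (x = k) * 1) * (of_bool (y = l) * (real y * \<mu> + (real s - real y) * (1 - \<mu>)))
     + (of_bool (x = k) * 1) * (of_bool (y = Suc l) * real y * (1 - \<mu>))
     + (of_bool (x = k) * 1) * (of_bool (l = Suc y) * (real s - real y) * \<mu>)
     + (real x * of_bool (x + y = k + l) + (real c - real x) * of_bool (Suc (x + y) = k + l))
         * (\<mu> * hypergeometric c s (int k) (int k + int l - 1))
     + (real x * of_bool (x + y = Suc (k + l)) + (real c - real x) * of_bool (x + y = k + l))
         * ((1 - \<mu>) * hypergeometric c s (int k) (int k + int l)))
    / (real c + real s)"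
proof -
  obtain D where D: "real c + real s = D" by blast
  then have nz: "D \<noteq> 0" using assms by auto
  show ?thesis
  proof (cases "k = x")
    case True
    have y: "l = y \<or> l = Suc y \<or> y = Suc l \<or> (l \<noteq> y \<and> l \<noteq> Suc y \<and> y \<noteq> Suc l)" by blast
    then show ?thesis
      using assms True nz
      unfolding D by (elim disjE; simp add: second_game_def states_def Let_def D; simp add: field_simps)
  next
    case False
    consider "x + y = k + l" | "x + y = Suc (k + l)" | "Suc (x + y) = k + l" "k \<le> x + y"
      | "Suc (x + y) = k + l" "x + y < k"
      | "x + y \<noteq> k + l" "x + y \<noteq> Suc (k + l)" "Suc (x + y) \<noteq> k + l" by linarith
    then show ?thesis
    proof cases
      case 1
      then have "int x + int y = int k + int l" by linarith
      with 1 False assms nz show ?thesis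
        unfolding D by (auto simp: second_game_def states_def Let_def D; simp add: field_simps)
    next
      case 2
      then have "int x + int y = int k + int l + 1" by linarith
      with 2 False assms nz show ?thesis
        unfolding D by (auto simp: second_game_def states_def Let_def D)
    next
      case 3
      then have "int x + int y = int k + int l - 1" by linarith
      with 3 False assms nz show ?thesis
        unfolding D by (auto simp: second_game_def states_def Let_def D)
    next
      \<comment> \<open>Here \<open>l = 0\<close> and the guard \<open>x' \<le> x + y\<close> of the
        matrix fails; the formula agrees because no sample has \<open>k\<close> out of
        \<open>k - 1\<close> red balls.\<close>
      case 4
      then have "int k + int l - 1 < int k" by linarith
      with 4 False assms nz show ?thesis
        unfolding D by (auto simp: second_game_def states_def Let_def D hypergeometric_eq_0)
    next
      case 5
      with False assms nz show ?thesis
        unfolding D by (auto simp: second_game_def states_def Let_def D)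
    qed
  qed
qed

lemma second_game_nonneg:
  assumes "i \<in> states c s" "j \<in> states c s" "s \<ge> 1" "0 < \<mu>" "\<mu> < 1"
  shows "0 \<le> second_game c s \<mu> i j"
proof -
  obtain x y k l where "i = (x, y)" "j = (k, l)" by fastforce
  with assms show ?thesis
    by (auto simp: states_def second_game_eq hypergeometric_nonneg
        intro!: divide_nonneg_nonneg add_nonneg_nonneg mult_nonneg_nonneg)
qed

text \<open>
  Throwing a uniformly chosen ball out of the first urn leaves \<open>c - 1 + s\<close> balls of
  independent random colours.
\<close>

lemma sum_weights_remove:
  assumes "c \<ge> 1"
  shows "(\<Sum>x\<in>{0..c}. \<Sum>y\<in>{0..s}. binomial_weight \<mu> c x * binomial_weight \<mu> s y *
      (real x * of_bool (x + y = Suc n) + (real c - real x) * of_bool (x + y = n)))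
    = real c * binomial_weight \<mu> (c - 1 + s) n"
proof -
  obtain m where c: "c = Suc m" using assms by (cases c) auto
  define V where "V = (\<Sum>u\<in>{0..m}. \<Sum>y\<in>{0..s}.
    binomial_weight \<mu> m u * binomial_weight \<mu> s y * of_bool (u + y = n))"
  \<comment> \<open>The term \<open>x = 0\<close> vanishes, and the shift \<open>x = Suc u\<close>
    accounts for the discarded red ball.\<close>
  have "(\<Sum>x\<in>{0..c}. \<Sum>y\<in>{0..s}. real x * binomial_weight \<mu> c x * binomial_weight \<mu> s y * of_bool (x + y = Suc n))
    = (\<Sum>u\<in>{0..m}. \<Sum>y\<in>{0..s}. real (Suc u) * binomial_weight \<mu> c (Suc u) * binomial_weight \<mu> s y * of_bool (u + y = n))"
    unfolding c by (subst sum.atLeast0_atMost_Suc_shift) (simp del: of_nat_Suc)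
  also have "\<dots> = real c * \<mu> * V"
    unfolding c binomial_weight_Suc_red V_def by (simp only: sum_distrib_left mult.assoc)
  finally have red: "(\<Sum>x\<in>{0..c}. \<Sum>y\<in>{0..s}. real x * binomial_weight \<mu> c x * binomial_weight \<mu> s y * of_bool (x + y = Suc n))
    = real c * \<mu> * V" .
  have "(\<Sum>x\<in>{0..c}. \<Sum>y\<in>{0..s}. (real c - real x) * binomial_weight \<mu> c x * binomial_weight \<mu> s y * of_bool (x + y = n))
    = (\<Sum>x\<in>{0..c}. \<Sum>y\<in>{0..s}. real c * (1 - \<mu>) * binomial_weight \<mu> m x * binomial_weight \<mu> s y * of_bool (x + y = n))"
    unfolding c binomial_weight_Suc_white ..
  \<comment> \<open>The term \<open>x = c\<close> drops out, as \<open>m = c - 1\<close> balls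
    cannot show \<open>c\<close> red ones.\<close>
  also have "\<dots> = real c * (1 - \<mu>) * V"
    unfolding c V_def by (simp add: sum_distrib_left mult_ac binomial_weight_eq_0 del: of_nat_Suc)
  finally have white: "(\<Sum>x\<in>{0..c}. \<Sum>y\<in>{0..s}. (real c - real x) * binomial_weight \<mu> c x * binomial_weight \<mu> s y * of_bool (x + y = n))
    = real c * (1 - \<mu>) * V" .
  have "(\<Sum>x\<in>{0..c}. \<Sum>y\<in>{0..s}. binomial_weight \<mu> c x * binomial_weight \<mu> s y *
      (real x * of_bool (x + y = Suc n) + (real c - real x) * of_bool (x + y = n)))
    = real c * \<mu> * V + real c * (1 - \<mu>) * V"
    unfolding red[symmetric] white[symmetric]
    by (simp add: sum.distrib[symmetric] distrib_left mult_ac)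
  also have "\<dots> = real c * V" by (simp add: algebra_simps)
  also have "V = binomial_weight \<mu> (m + s) n"
    unfolding V_def by (rule binomial_weight_vandermonde)
  finally show ?thesis by (simp only: c diff_Suc_1)
qed

lemma second_game_invariant:
  assumes "k \<le> c" "l \<le> s" "c \<ge> 1" "s \<ge> 1"
  shows "(\<Sum>i\<in>states c s. binomial_product c s \<mu> i * second_game c s \<mu> i (k, l))
    = binomial_product c s \<mu> (k, l)"
proof -
  let ?N = "real c + real s"
  have nz: "?N \<noteq> 0" using assms by auto
  define a where "a = binomial_weight \<mu> c"
  define b where "b = binomial_weight \<mu> s"
  define q1 where "q1 = hypergeometric c s (int k) (int k + int l - 1)"
  define q0 where "q0 = hypergeometric c s (int k) (int k + int l)"
  \<comment> \<open>Up to the factor \<open>c\<close>, \<open>T1\<close> and \<open>T0\<close> are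
    the probabilities that throwing out a ball of the first urn leaves \<open>k + l - 1\<close> and
    \<open>k + l\<close> red balls.\<close>
  define T1 where "T1 = (\<Sum>x\<in>{0..c}. \<Sum>y\<in>{0..s}. a x * b y *
      (real x * of_bool (x + y = k + l) + (real c - real x) * of_bool (Suc (x + y) = k + l)))"
  define T0 where "T0 = (\<Sum>x\<in>{0..c}. \<Sum>y\<in>{0..s}. a x * b y *
      (real x * of_bool (x + y = Suc (k + l)) + (real c - real x) * of_bool (x + y = k + l)))"
  obtain t where s: "s = Suc t" using assms by (cases s) auto
  have ct: "c - 1 + s = c + t" using assms s by simp
  have T0: "T0 * ((1 - \<mu>) * q0) = real c * (1 - \<mu>) * (a k * binomial_weight \<mu> t l)"
  proof -
    have "T0 = real c * binomial_weight \<mu> (c + t) (k + l)"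
      unfolding T0_def a_def b_def sum_weights_remove[OF assms(3)] ct ..
    moreover have "binomial_weight \<mu> (c + t) (k + l) * q0 = a k * binomial_weight \<mu> t l"
      using binomial_weight_hypergeometric[OF assms(1), of \<mu> t "k + l"] by (simp add: q0_def a_def s)
    ultimately show ?thesis by (metis mult.assoc mult.commute)
  qed
  have T1: "T1 * (\<mu> * q1) = real c * \<mu> * (a k * (if l = 0 then 0 else binomial_weight \<mu> t (l - 1)))"
  proof (cases "l = 0")
    \<comment> \<open>A red bag ball excludes \<open>l = 0\<close>: there \<open>q1\<close>
      vanishes, though \<open>T1\<close> may be positive.\<close>
    case True
    then show ?thesis by (simp add: q1_def hypergeometric_eq_0)
  next
    case False
    then obtain r where l: "l = Suc r" by (cases l) auto
    have "T1 = real c * binomial_weight \<mu> (c + t) (k + r)"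
      using sum_weights_remove[OF assms(3), of \<mu> s "k + r"] unfolding T1_def a_def b_def ct l by simp
    moreover have "binomial_weight \<mu> (c + t) (k + r) * q1 = a k * binomial_weight \<mu> t r"
      using binomial_weight_hypergeometric[OF assms(1), of \<mu> t "k + r"] by (simp add: q1_def a_def s l)
    ultimately have "T1 * (\<mu> * q1) = real c * \<mu> * (a k * binomial_weight \<mu> t r)"
      by (metis mult.assoc mult.commute)
    then show ?thesis by (simp add: l)
  qed
  \<comment> \<open>Refilling the second urn: \<open>t\<close> binomial balls and one bag ball make
    \<open>s\<close> binomial balls. The absorption identities enter with coefficients
    \<open>l\<close> and \<open>s - l\<close>, whose sum is \<open>s\<close>.\<close>
  have add: "\<mu> * (if l = 0 then 0 else binomial_weight \<mu> t (l - 1)) + (1 - \<mu>) * binomial_weight \<mu> t l = b l"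
  proof (cases l)
    case 0
    then show ?thesis by (simp add: b_def s binomial_weight_def)
  next
    case (Suc r)
    have "real (Suc t) * (\<mu> * binomial_weight \<mu> t r + (1 - \<mu>) * binomial_weight \<mu> t l)
      = real (Suc t) * \<mu> * binomial_weight \<mu> t r + real (Suc t) * (1 - \<mu>) * binomial_weight \<mu> t l"
      by (simp only: distrib_left mult.assoc)
    also have "\<dots> = real (Suc t) * b l"
      unfolding b_def s binomial_weight_Suc_red[symmetric] binomial_weight_Suc_white[symmetric] Suc
      by (simp only: distrib_right[symmetric]) simp
    finally show ?thesis unfolding Suc by simp
  qed
  have "(\<Sum>i\<in>states c s. binomial_product c s \<mu> i * second_game c s \<mu> i (k, l)) * ?N
    = (\<Sum>x\<in>{0..c}. \<Sum>y\<in>{0..s}. binomial_weight \<mu> c x * binomial_weight \<mu> s y *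
       (second_game c s \<mu> (x, y) (k, l) * ?N))"
    by (simp only: sum_states sum_distrib_right binomial_product_eq mult.assoc)
  also have "\<dots> = (\<Sum>x\<in>{0..c}. \<Sum>y\<in>{0..s}. binomial_weight \<mu> c x * binomial_weight \<mu> s y *
     ((of_bool (x = k) * 1) * (of_bool (y = l) * (real y * \<mu> + (real s - real y) * (1 - \<mu>)))
     + (of_bool (x = k) * 1) * (of_bool (y = Suc l) * real y * (1 - \<mu>))
     + (of_bool (x = k) * 1) * (of_bool (l = Suc y) * (real s - real y) * \<mu>)
     + (real x * of_bool (x + y = k + l) + (real c - real x) * of_bool (Suc (x + y) = k + l)) * (\<mu> * q1)
     + (real x * of_bool (x + y = Suc (k + l)) + (real c - real x) * of_bool (x + y = k + l))
         * ((1 - \<mu>) * q0)))"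
    using assms nz unfolding q0_def q1_def
    by (intro sum.cong refl arg_cong2[where f = "(*)"])
      (simp only: second_game_eq atLeastAtMost_iff times_divide_eq_left nonzero_mult_div_cancel_right not_False_eq_True)
  also have "\<dots> = (1 * a k) * ((real l * \<mu> + (real s - real l) * (1 - \<mu>)) * b l)
     + (1 * a k) * ((real s - real l) * \<mu> * b l) + (1 * a k) * (real l * (1 - \<mu>) * b l)
     + T1 * (\<mu> * q1) + T0 * ((1 - \<mu>) * q0)"
    unfolding distrib_left[of "binomial_weight \<mu> c _ * binomial_weight \<mu> s _"] sum.distrib sum_weights_product
      mult.assoc[symmetric, of "binomial_weight \<mu> c _ * binomial_weight \<mu> s _" "_ + _"]
      sum_distrib_right[symmetric]
    by (simp only: sum_weight_red_loss sum_weight_red_gain[OF assms(2)] sum_weight_stay[OF assms(1)]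
        sum_weight_stay[OF assms(2)] T1_def T0_def a_def b_def distrib_left distrib_right sum.distrib)
  \<comment> \<open>Rounds with b_0 in the second urn contribute the part with
    \<open>real s\<close>, reshuffling rounds the part with \<open>real c\<close>.\<close>
  also have "\<dots> = a k * (real s * b l) + real c * (a k * b l)"
    unfolding T0 T1 add[symmetric] by (simp add: algebra_simps)
  also have "\<dots> = a k * b l * ?N" by (simp add: algebra_simps)
  finally have "(\<Sum>i\<in>states c s. binomial_product c s \<mu> i * second_game c s \<mu> i (k, l)) = a k * b l"
    using nz by (metis mult_right_cancel)
  then show ?thesis by (simp add: binomial_product_eq a_def b_def)
qed

subsection \<open>Irreducibility and the stationary law\<close>

lemma binomial_product_pos:
  assumes "0 < \<mu>" "\<mu> < 1" "i \<in> states c s"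
  shows "0 < binomial_product c s \<mu> i"
  using assms by (auto simp: states_def binomial_product_def)

lemma sum_binomial_product: "(\<Sum>i\<in>states c s. binomial_product c s \<mu> i) = 1"
proof -
  have "(\<Sum>i\<in>states c s. binomial_product c s \<mu> i)
    = (\<Sum>x\<in>{0..c}. binomial_weight \<mu> c x) * (\<Sum>y\<in>{0..s}. binomial_weight \<mu> s y)"
    by (simp add: sum_states binomial_product_eq sum_product)
  then show ?thesis by (simp add: sum_binomial_weight)
qed

lemma first_game_irreducible:
  assumes "s \<ge> 1" "0 < \<mu>" "\<mu> < 1"
    and "Z \<subseteq> states c s" "Z \<noteq> {}"
    and "\<And>i j. j \<in> Z \<Longrightarrow> i \<in> states c s \<Longrightarrow> 0 < first_game c s \<mu> i j \<Longrightarrow> i \<in> Z"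
  shows "Z = states c s"
proof (rule states_irreducible[where P = "first_game c s \<mu>"])
  fix x y assume "x \<le> c" "y < s"
  then show "0 < first_game c s \<mu> (x, y) (x, Suc y)" "0 < first_game c s \<mu> (x, Suc y) (x, y)"
    using assms(1-3) by (simp_all add: first_game_eq add_nonneg_pos add_pos_nonneg)
next
  fix x assume "x < c"
  then show "0 < first_game c s \<mu> (Suc x, 0) (x, 0)" "0 < first_game c s \<mu> (x, 1) (Suc x, 0)"
    using assms(1-3) by (simp_all add: first_game_eq)
qed (use assms in auto)

text \<open>Within a column, throwing a ball from the second urn has positive probability; between
  columns, the reshuffle that puts all remaining red balls into the first urn does.\<close>

lemma second_game_irreducible:
  assumes "s \<ge> 1" "0 < \<mu>" "\<mu> < 1"
    and "Z \<subseteq> states c s" "Z \<noteq> {}"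
    and "\<And>i j. j \<in> Z \<Longrightarrow> i \<in> states c s \<Longrightarrow> 0 < second_game c s \<mu> i j \<Longrightarrow> i \<in> Z"
  shows "Z = states c s"
proof -
  have N: "0 < real c + real s" using assms(1) by simp
  show ?thesis
  proof (rule states_irreducible[where P = "second_game c s \<mu>"])
    fix x y assume "x \<le> c" "y < s"
    then show "0 < second_game c s \<mu> (x, y) (x, Suc y)" "0 < second_game c s \<mu> (x, Suc y) (x, y)"
      using assms(1-3)
      by (auto simp: second_game_eq hypergeometric_nonneg intro!: divide_pos_pos[OF _ N] add_pos_nonneg)
  next
    fix x assume "x < c"
    then show "0 < second_game c s \<mu> (Suc x, 0) (x, 0)" "0 < second_game c s \<mu> (x, 1) (Suc x, 0)"
      using assms(1-3) hypergeometric_all_red_pos[of x c s] hypergeometric_all_red_pos[of "Suc x" c s]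
      by (auto simp: second_game_eq hypergeometric_nonneg intro!: divide_pos_pos[OF _ N] add_nonneg_pos)
  qed (use assms in auto)
qed

theorem theorem1:
  fixes c s :: nat and \<mu> :: real
    and P :: "nat \<times> nat \<Rightarrow> nat \<times> nat \<Rightarrow> real"
    and M :: "'w measure" and X :: "nat \<Rightarrow> 'w \<Rightarrow> nat \<times> nat"
  assumes "c \<ge> 1" and "s \<ge> 1" and "0 < \<mu>" and "\<mu> < 1"
    and "P = first_game c s \<mu> \<or> P = second_game c s \<mu>"
    and "markov_chain M (states c s) P (binomial_product c s \<mu>) X"
  shows "(\<forall>\<pi>. stationary_solution (states c s) P \<pi> \<longleftrightarrow>
             (\<forall>z\<in>states c s. \<pi> z = binomial_product c s \<mu> z)) \<and>
         (\<forall>x\<in>{0..c}. \<forall>y\<in>{0..s}.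
             (\<lambda>n. \<P>(\<omega> in M. X n \<omega> = (x, y))) \<longlonglongrightarrow> binomial_product c s \<mu> (x, y))"
proof -
  let ?S = "states c s" and ?\<alpha> = "binomial_product c s \<mu>"
  have fin: "finite ?S" by (simp add: states_def)
  have "(\<Sum>i\<in>?S. ?\<alpha> i * P i (k, l)) = ?\<alpha> (k, l)" if "k \<le> c" "l \<le> s" for k l
    using assms(5) first_game_invariant[OF that assms(2)] second_game_invariant[OF that assms(1,2)]
    by auto
  then have st: "stationary_solution ?S P ?\<alpha>"
    by (auto simp: stationary_solution_def states_def[of c s] sum_binomial_product[unfolded states_def])
  have nonneg: "0 \<le> P i j" if "i \<in> ?S" "j \<in> ?S" for i j
    using assms(2-5) first_game_nonneg[OF that] second_game_nonneg[OF that] by auto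
  have irr: "Z = ?S" if "Z \<subseteq> ?S" "Z \<noteq> {}" "\<And>i j. j \<in> Z \<Longrightarrow> i \<in> ?S \<Longrightarrow> 0 < P i j \<Longrightarrow> i \<in> Z" for Z
    using assms(5) that(3) first_game_irreducible[OF assms(2-4) that(1,2)]
      second_game_irreducible[OF assms(2-4) that(1,2)] by blast
  have "stationary_solution ?S P \<pi> \<longleftrightarrow> (\<forall>z\<in>?S. \<pi> z = ?\<alpha> z)" for \<pi>
  proof
    assume "stationary_solution ?S P \<pi>"
    then show "\<forall>z\<in>?S. \<pi> z = ?\<alpha> z"
      using stationary_solution_unique[OF fin nonneg irr _ st] binomial_product_pos[OF assms(3,4)]
      by blast
  next
    assume "\<forall>z\<in>?S. \<pi> z = ?\<alpha> z"
    then show "stationary_solution ?S P \<pi>"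
      using st stationary_solution_cong[of ?S \<pi> ?\<alpha> P] by blast
  qed
  moreover have "(\<lambda>n. \<P>(\<omega> in M. X n \<omega> = (x, y))) \<longlonglongrightarrow> ?\<alpha> (x, y)"
    if "x \<in> {0..c}" "y \<in> {0..s}" for x y
    using markov_chain_stationary_law[OF assms(6) fin st, of "(x, y)"] that
    by (simp add: states_def)
  ultimately show ?thesis by blast
qed

end
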